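(* For every integer $n \geq 2$, the following hold: (i) The minimum degree of $\mathcal{P}_e(D_{2n})$ is $1$. (ii) The independence number of $\mathcal{P}_e(D_{2n})$ is $n+1$. (iii) The matching number of $\mathcal{P}_e(D_{2n})$ is $\lceil \frac{n}{2} \rceil$. (iv) The strong metric dimension of $\mathcal{P}_e(D_{2n})$ is $2(n-1)$.
   Context: $D_{2n} = \langle a, b : a^{n} = b^2 = e,\ ab = ba^{-1} \rangle$ is the dihedral group of order $2n$. The enhanced power graph $\mathcal{P}_e(G)$ of a group $G$ is the simple undirected graph with vertex set $G$ in which two distinct vertices are adjacent if and only if they belong to a common cyclic subgroup of $G$. The independence number is the largest cardinality of a set of pairwise non-adjacent vertices; the matching number is the maximum cardinality of a set of edges no two of which share an endpoint. For vertices $u,v$ of a graph $\Gamma$, a vertex $z$ strongly resolves $u$ and $v$ if there is a shortest path from $z$ to $u$ containing $v$, or a shortest path from $z$ to $v$ containing $u$; a strong resolving set is a set $U$ of vertices such that every pair of (distinct) vertices of $\Gamma$ is strongly resolved by some vertex of $U$; the strong metric dimension is the least cardinality of a strong resolving set. *)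

theory Defs
  imports Complex_Main "HOL-Algebra.Algebra"
begin

section \<open>Dihedral groups\<close>

text \<open>
  \<open>is_dihedral G a b n\<close> says that \<open>G\<close> is the dihedral group of order \<open>2 * n\<close> with the presentation
  \<open>\<langle>a, b : a ^ n = b ^ 2 = e, a b = b a ^ (- 1)\<rangle>\<close>. The condition on the order rules out proper
  quotients of the presented group; \<open>is_dihedral_universal\<close> below shows that \<open>G\<close> then has the universal
  property of the presentation, and \<open>is_dihedral_exists\<close> that such a \<open>G\<close> exists for every \<open>n > 0\<close>.
\<close>

definition is_dihedral :: "('a, 'm) monoid_scheme \<Rightarrow> 'a \<Rightarrow> 'a \<Rightarrow> nat \<Rightarrow> bool" where
  "is_dihedral G a b n \<longleftrightarrow>
     group G \<and> a \<in> carrier G \<and> b \<in> carrier G \<and>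
     generate G {a, b} = carrier G \<and>
     a [^]\<^bsub>G\<^esub> n = \<one>\<^bsub>G\<^esub> \<and> b [^]\<^bsub>G\<^esub> (2::nat) = \<one>\<^bsub>G\<^esub> \<and>
     a \<otimes>\<^bsub>G\<^esub> b = b \<otimes>\<^bsub>G\<^esub> inv\<^bsub>G\<^esub> a \<and>
     order G = 2 * n"

lemma (in group) generate_dihedral_subset:
  fixes n :: nat
  assumes a: "a \<in> carrier G" and b: "b \<in> carrier G" and n: "n > 0"
    and an: "a [^] n = \<one>" and bb: "b [^] (2::nat) = \<one>" and ab: "a \<otimes> b = b \<otimes> inv a"
  shows "generate G {a, b} \<subseteq> (\<lambda>(i, s). a [^] i \<otimes> (if s then b else \<one>)) ` ({..<n} \<times> UNIV)"
proof -
  have bb': "b \<otimes> b = \<one>"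
    using bb b by (simp add: numeral_2_eq_2)
  have ib: "inv b = b"
    using bb' b by (simp add: inv_equality)
  have "inv a = b \<otimes> a \<otimes> inv b"
    using a b ab bb' ib by (metis inv_closed inv_solve_left m_assoc m_closed l_one)
  then have conj: "b \<otimes> a [^] (i::int) \<otimes> b = inv a [^] i" for i
  proof -
    have "b \<otimes> a [^] (k::nat) \<otimes> b = inv a [^] k" for k
    proof (induction k)
      case 0
      then show ?case using b bb' by simp
    next
      case (Suc k)
      have "b \<otimes> a [^] Suc k \<otimes> b = b \<otimes> a [^] k \<otimes> (b \<otimes> b) \<otimes> a \<otimes> b"
        using a b bb' by (simp add: m_assoc)
      also have "\<dots> = (b \<otimes> a [^] k \<otimes> b) \<otimes> (b \<otimes> a \<otimes> b)"
        using a b by (simp add: m_assoc)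
      finally show ?case
        using Suc \<open>inv a = b \<otimes> a \<otimes> inv b\<close> ib by simp
    qed note nat_case = this
    show ?thesis
    proof (cases "i \<ge> 0")
      case True
      then obtain k where "i = int k" using nonneg_int_cases by blast
      then show ?thesis using nat_case by (simp add: int_pow_int)
    next
      case False
      then obtain k where k: "i = - int k" by (metis nle_le uminus_int_code(1) zero_le_imp_eq_int neg_0_le_iff_le add.inverse_inverse)
      have "inv (b \<otimes> a [^] k \<otimes> b) = b \<otimes> inv (a [^] k) \<otimes> b"
        using a b ib by (simp add: inv_mult_group m_assoc)
      then show ?thesis
        using nat_case[of k] k a by (simp add: int_pow_neg int_pow_int)
    qed
  qed
  have swap: "b \<otimes> a [^] (i::int) = a [^] (- i) \<otimes> b" for i
  proof -
    have "b \<otimes> a [^] i = b \<otimes> a [^] i \<otimes> b \<otimes> b"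
      using a b bb' by (simp add: m_assoc)
    then show ?thesis
      using conj[of i] a by (simp add: int_pow_neg int_pow_inv)
  qed
  define T where "T = {a [^] (i::int) \<otimes> (if s then b else \<one>) | i s. True}"
  have red: "a [^] (i::int) = a [^] nat (i mod int n)" for i
  proof -
    have "a [^] i = a [^] (int n * (i div int n)) \<otimes> a [^] (i mod int n)"
      using a by (simp flip: int_pow_mult)
    also have "a [^] (int n * (i div int n)) = \<one>"
      using a an by (simp add: int_pow_int flip: int_pow_pow)
    finally have "a [^] i = a [^] (i mod int n)"
      using a by simp
    also have "i mod int n = int (nat (i mod int n))"
      using n by simp
    finally show ?thesis
      by (metis int_pow_int)
  qed
  have T0: "a [^] (i::int) \<otimes> (if s then b else \<one>) \<in> T" for i s
    unfolding T_def by blast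
  have T1: "a [^] (i::int) \<in> T" and T2: "a [^] (i::int) \<otimes> b \<in> T" for i
    using T0[of i False] T0[of i True] a by auto
  have "x \<in> T" if "x \<in> generate G {a, b}" for x
    using that
  proof induction
    case one
    show ?case using T1[of 0] by simp
  next
    case (incl h)
    then show ?case using T1[of 1] T2[of 0] a b by auto
  next
    case (inv h)
    then show ?case using T1[of "-1"] T2[of 0] a b ib by (auto simp: int_pow_neg)
  next
    case (eng x y)
    obtain i s where x: "x = a [^] (i::int) \<otimes> (if s then b else \<one>)"
      using eng.IH(1) unfolding T_def by blast
    obtain j t where y: "y = a [^] (j::int) \<otimes> (if t then b else \<one>)"
      using eng.IH(2) unfolding T_def by blast
    show ?case
    proof (cases s)
      case False
      then have "x \<otimes> y = a [^] (i + j) \<otimes> (if t then b else \<one>)"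
        using x y a b by (simp add: int_pow_mult m_assoc)
      then show ?thesis unfolding T_def by blast
    next
      case True
      then have "x \<otimes> y = a [^] i \<otimes> (b \<otimes> a [^] j) \<otimes> (if t then b else \<one>)"
        using x y a b by (simp add: m_assoc)
      also have "\<dots> = a [^] (i - j) \<otimes> (b \<otimes> (if t then b else \<one>))"
        using a b int_pow_mult[OF a, of i "- j"] unfolding swap by (simp add: m_assoc)
      finally show ?thesis using T1[of "i - j"] T2[of "i - j"] a b bb' by (cases t) auto
    qed
  qed
  moreover have "T \<subseteq> (\<lambda>(i, s). a [^] i \<otimes> (if s then b else \<one>)) ` ({..<n} \<times> UNIV)"
  proof
    fix x assume "x \<in> T"
    then obtain i s where x: "x = a [^] (i::int) \<otimes> (if s then b else \<one>)"
      unfolding T_def by blast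
    have "nat (i mod int n) < n"
      using n by (simp add: nat_less_iff)
    then show "x \<in> (\<lambda>(i, s). a [^] i \<otimes> (if s then b else \<one>)) ` ({..<n} \<times> UNIV)"
      using x red[of i] by (intro image_eqI[of _ _ "(nat (i mod int n), s)"]) auto
  qed
  ultimately show ?thesis by blast
qed

lemma is_dihedral_universal:
  fixes G :: "('a, 'm) monoid_scheme" and H :: "('b, 'l) monoid_scheme"
  assumes G: "is_dihedral G a b n" and n: "n > 0" and H: "group H"
    and xy: "x \<in> carrier H" "y \<in> carrier H"
    and rels: "x [^]\<^bsub>H\<^esub> n = \<one>\<^bsub>H\<^esub>" "y [^]\<^bsub>H\<^esub> (2::nat) = \<one>\<^bsub>H\<^esub>" "x \<otimes>\<^bsub>H\<^esub> y = y \<otimes>\<^bsub>H\<^esub> inv\<^bsub>H\<^esub> x"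
  shows "\<exists>h \<in> hom G H. h a = x \<and> h b = y"
proof -
  interpret G: group G using G by (simp add: is_dihedral_def)
  interpret H: group H by (fact H)
  interpret P: group "G \<times>\<times> H" by (simp add: DirProd_group G.group_axioms H)
  have ab: "a \<in> carrier G" "b \<in> carrier G" and gen: "generate G {a, b} = carrier G"
    and ord: "order G = 2 * n"
    and Grels: "a [^]\<^bsub>G\<^esub> n = \<one>\<^bsub>G\<^esub>" "b [^]\<^bsub>G\<^esub> (2::nat) = \<one>\<^bsub>G\<^esub>" "a \<otimes>\<^bsub>G\<^esub> b = b \<otimes>\<^bsub>G\<^esub> inv\<^bsub>G\<^esub> a"
    using G by (auto simp: is_dihedral_def)
  define R where "R = generate (G \<times>\<times> H) {(a, x), (b, y)}"
  have sub: "R \<subseteq> carrier (G \<times>\<times> H)"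
    unfolding R_def using ab xy by (intro P.generate_incl) auto
  have pow: "(u, v) [^]\<^bsub>G \<times>\<times> H\<^esub> (k::nat) = (u [^]\<^bsub>G\<^esub> k, v [^]\<^bsub>H\<^esub> k)" for u v k
    by (induction k) (auto simp: nat_pow_def)
  have "R \<subseteq> (\<lambda>(i, s). (a, x) [^]\<^bsub>G \<times>\<times> H\<^esub> i \<otimes>\<^bsub>G \<times>\<times> H\<^esub> (if s then (b, y) else \<one>\<^bsub>G \<times>\<times> H\<^esub>)) ` ({..<n} \<times> UNIV)"
    unfolding R_def using ab xy n Grels rels
    by (intro P.generate_dihedral_subset)
       (auto simp: pow inv_DirProd[OF G.group_axioms H])
  note Rsub = this
  have finR: "finite R"
    by (rule finite_subset[OF Rsub]) auto
  have cardR: "card R \<le> 2 * n"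
    using surj_card_le[OF _ Rsub] by (simp add: card_cartesian_product mult.commute)
  have surj: "carrier G \<subseteq> fst ` R"
  proof
    fix g assume "g \<in> carrier G"
    then have "g \<in> generate G {a, b}" using gen by simp
    then have "\<exists>h. (g, h) \<in> R"
    proof induction
      case one
      show ?case using generate.one[of "G \<times>\<times> H" "{(a, x), (b, y)}"] unfolding R_def by auto
    next
      case (incl h)
      then show ?case unfolding R_def by (auto intro: generate.incl)
    next
      case (inv h)
      then obtain k where k: "(h, k) \<in> {(a, x), (b, y)}" by auto
      then have "inv\<^bsub>G \<times>\<times> H\<^esub> (h, k) \<in> R" unfolding R_def by (rule generate.inv)
      then show ?case using k ab xy by (auto simp: inv_DirProd[OF G.group_axioms H])
    next
      case (eng g1 g2)
      then obtain h1 h2 where "(g1, h1) \<in> R" "(g2, h2) \<in> R" by blast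
      then have "(g1, h1) \<otimes>\<^bsub>G \<times>\<times> H\<^esub> (g2, h2) \<in> R" unfolding R_def by (rule generate.eng)
      then show ?case by auto
    qed
    then show "g \<in> fst ` R" by force
  qed
  have img: "fst ` R = carrier G"
    using surj sub by (auto simp: DirProd_def)
  have "card (fst ` R) = card R"
    using card_image_le[OF finR, of fst] cardR ord unfolding img order_def by simp
  then have inj: "inj_on fst R"
    using finR eq_card_imp_inj_on by blast
  then have ex1: "\<exists>!h. (g, h) \<in> R" if "g \<in> carrier G" for g
    using that img unfolding inj_on_def by force
  define h where "h g = (THE h. (g, h) \<in> R)" for g
  have hR: "(g, h g) \<in> R" if "g \<in> carrier G" for g
    unfolding h_def by (rule theI'[OF ex1[OF that]])
  have hI: "h g = k" if "(g, k) \<in> R" for g k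
    using that sub ex1[of g] hR[of g] by (auto simp: DirProd_def)
  have "h \<in> hom G H"
  proof (rule homI)
    fix g1 assume "g1 \<in> carrier G"
    then show "h g1 \<in> carrier H" using hR sub by (force simp: DirProd_def)
  next
    fix g1 g2 assume "g1 \<in> carrier G" "g2 \<in> carrier G"
    then have "(g1, h g1) \<otimes>\<^bsub>G \<times>\<times> H\<^esub> (g2, h g2) \<in> R"
      using hR generate.eng unfolding R_def by metis
    then show "h (g1 \<otimes>\<^bsub>G\<^esub> g2) = h g1 \<otimes>\<^bsub>H\<^esub> h g2" by (intro hI) auto
  qed
  moreover have "h a = x" "h b = y"
    by (auto intro!: hI generate.incl simp: R_def)
  ultimately show ?thesis by blast
qed

lemma is_dihedral_exists:
  assumes n: "n > 0"
  shows "\<exists>(G :: (int \<times> bool) monoid) a b. is_dihedral G a b n"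
proof -
  define G :: "(int \<times> bool) monoid" where
    "G = \<lparr>carrier = {0..<int n} \<times> UNIV,
          monoid.mult = (\<lambda>(i, s) (j, t). ((i + (if s then - j else j)) mod int n, s \<noteq> t)),
          one = (0, False)\<rparr>"
  define a b where "a = (1 mod int n, False)" and "b = (0::int, True)"
  have carr: "carrier G = {0..<int n} \<times> UNIV"
    and mul: "(i, s) \<otimes>\<^bsub>G\<^esub> (j, t) = ((i + (if s then - j else j)) mod int n, s \<noteq> t)"
    and one: "\<one>\<^bsub>G\<^esub> = (0, False)" for i s j t
    by (auto simp: G_def)
  interpret G: group G
  proof (rule groupI)
    fix x y z assume "x \<in> carrier G" "y \<in> carrier G" "z \<in> carrier G"
    then show "x \<otimes>\<^bsub>G\<^esub> y \<otimes>\<^bsub>G\<^esub> z = x \<otimes>\<^bsub>G\<^esub> (y \<otimes>\<^bsub>G\<^esub> z)"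
      by (cases x; cases y; cases z) (auto simp: mul mod_simps algebra_simps)
  next
    fix x assume x: "x \<in> carrier G"
    obtain i s where x_eq: "x = (i, s)" by (cases x)
    have "((if s then i else (- i) mod int n), s) \<in> carrier G"
      using x n x_eq by (auto simp: carr)
    moreover have "((if s then i else (- i) mod int n), s) \<otimes>\<^bsub>G\<^esub> x = \<one>\<^bsub>G\<^esub>"
      using x_eq by (auto simp: mul one mod_simps)
    ultimately show "\<exists>y \<in> carrier G. y \<otimes>\<^bsub>G\<^esub> x = \<one>\<^bsub>G\<^esub>" by blast
  qed (use n in \<open>auto simp: carr mul one\<close>)
  have ab: "a \<in> carrier G" "b \<in> carrier G"
    using n by (auto simp: a_def b_def carr)
  have apow: "a [^]\<^bsub>G\<^esub> (k::nat) = (int k mod int n, False)" for k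
    by (induction k) (auto simp: one mul a_def mod_simps algebra_simps)
  have ia: "inv\<^bsub>G\<^esub> a = ((- 1) mod int n, False)"
    using n by (intro G.inv_equality) (auto simp: a_def mul one carr mod_simps)
  have gen: "generate G {a, b} = carrier G"
  proof
    show "generate G {a, b} \<subseteq> carrier G" using ab by (intro G.generate_incl) auto
  next
    have powgen: "a [^]\<^bsub>G\<^esub> (k::nat) \<in> generate G {a, b}" for k
      by (induction k) (auto intro: generate.intros)
    show "carrier G \<subseteq> generate G {a, b}"
    proof
      fix x assume x: "x \<in> carrier G"
      obtain i s where x_eq: "x = (i, s)" by (cases x)
      have "x = a [^]\<^bsub>G\<^esub> nat i \<otimes>\<^bsub>G\<^esub> (if s then b else \<one>\<^bsub>G\<^esub>)"
        using x x_eq by (auto simp: apow mul one carr b_def)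
      then show "x \<in> generate G {a, b}"
        using powgen by (auto intro: generate.intros)
    qed
  qed
  have "is_dihedral G a b n"
    unfolding is_dihedral_def
    using ab gen n
    by (auto simp: G.group_axioms apow ia one numeral_2_eq_2 mul order_def carr card_cartesian_product)
       (auto simp: a_def b_def mul mod_simps)
  then show ?thesis by blast
qed


section \<open>Simple graphs\<close>

record 'a graph =
  verts :: "'a set"
  edges :: "'a set set"

definition simple_graph :: "'a graph \<Rightarrow> bool" where
  "simple_graph \<Gamma> \<longleftrightarrow> (\<forall>e \<in> edges \<Gamma>. e \<subseteq> verts \<Gamma> \<and> card e = 2)"

definition adj :: "'a graph \<Rightarrow> 'a \<Rightarrow> 'a \<Rightarrow> bool" where
  "adj \<Gamma> u v \<longleftrightarrow> {u, v} \<in> edges \<Gamma>"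

definition degree :: "'a graph \<Rightarrow> 'a \<Rightarrow> nat" where
  "degree \<Gamma> v = card {e \<in> edges \<Gamma>. v \<in> e}"

text \<open>
  The graph invariants below use \<open>Min\<close> and \<open>Max\<close>, which are meaningful since they are only applied to
  finite graphs with at least one vertex.
\<close>

definition min_degree :: "'a graph \<Rightarrow> nat" where
  "min_degree \<Gamma> = Min (degree \<Gamma> ` verts \<Gamma>)"

definition independent_set :: "'a graph \<Rightarrow> 'a set \<Rightarrow> bool" where
  "independent_set \<Gamma> S \<longleftrightarrow> S \<subseteq> verts \<Gamma> \<and> (\<forall>u \<in> S. \<forall>v \<in> S. u \<noteq> v \<longrightarrow> \<not> adj \<Gamma> u v)"

definition independence_number :: "'a graph \<Rightarrow> nat" where
  "independence_number \<Gamma> = Max {card S | S. independent_set \<Gamma> S}"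

definition matching :: "'a graph \<Rightarrow> 'a set set \<Rightarrow> bool" where
  "matching \<Gamma> M \<longleftrightarrow> M \<subseteq> edges \<Gamma> \<and> (\<forall>e \<in> M. \<forall>f \<in> M. e \<noteq> f \<longrightarrow> e \<inter> f = {})"

definition matching_number :: "'a graph \<Rightarrow> nat" where
  "matching_number \<Gamma> = Max {card M | M. matching \<Gamma> M}"

definition is_path :: "'a graph \<Rightarrow> 'a \<Rightarrow> 'a list \<Rightarrow> 'a \<Rightarrow> bool" where
  "is_path \<Gamma> u p v \<longleftrightarrow>
     p \<noteq> [] \<and> hd p = u \<and> last p = v \<and> distinct p \<and> set p \<subseteq> verts \<Gamma> \<and> successively (adj \<Gamma>) p"

definition shortest_path :: "'a graph \<Rightarrow> 'a \<Rightarrow> 'a list \<Rightarrow> 'a \<Rightarrow> bool" where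
  "shortest_path \<Gamma> u p v \<longleftrightarrow> is_path \<Gamma> u p v \<and> (\<forall>q. is_path \<Gamma> u q v \<longrightarrow> length p \<le> length q)"

definition strongly_resolves :: "'a graph \<Rightarrow> 'a \<Rightarrow> 'a \<Rightarrow> 'a \<Rightarrow> bool" where
  "strongly_resolves \<Gamma> z u v \<longleftrightarrow>
     (\<exists>p. shortest_path \<Gamma> z p u \<and> v \<in> set p) \<or> (\<exists>p. shortest_path \<Gamma> z p v \<and> u \<in> set p)"

definition strong_resolving_set :: "'a graph \<Rightarrow> 'a set \<Rightarrow> bool" where
  "strong_resolving_set \<Gamma> U \<longleftrightarrow> U \<subseteq> verts \<Gamma> \<and>
     (\<forall>u \<in> verts \<Gamma>. \<forall>v \<in> verts \<Gamma>. u \<noteq> v \<longrightarrow> (\<exists>z \<in> U. strongly_resolves \<Gamma> z u v))"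

definition strong_metric_dimension :: "'a graph \<Rightarrow> nat" where
  "strong_metric_dimension \<Gamma> = Min {card U | U. strong_resolving_set \<Gamma> U}"


section \<open>Enhanced power graphs\<close>

definition enhanced_power_graph :: "('a, 'm) monoid_scheme \<Rightarrow> 'a graph" where
  "enhanced_power_graph G =
     \<lparr>verts = carrier G,
      edges = {{x, y} | x y. x \<noteq> y \<and>
        (\<exists>C. subgroup C G \<and> cyclic_group (G\<lparr>carrier := C\<rparr>) \<and> x \<in> C \<and> y \<in> C)}\<rparr>"

lemma simple_graph_enhanced_power_graph: "simple_graph (enhanced_power_graph G)"
  by (auto simp: simple_graph_def enhanced_power_graph_def dest: subgroup.subset)

end

theory Submission
  imports Defs
begin

text \<open>
  In \<open>D\<^sub>2\<^sub>n\<close> every element outside \<open>\<langle>a\<rangle>\<close> is an involution, so it shares a cyclic subgroup only with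
  itself and the identity. Hence the enhanced power graph is the complete graph on \<open>\<langle>a\<rangle>\<close> with \<open>n\<close>
  pendant vertices attached to the identity, and all four invariants are read off from this shape.
  For the strong metric dimension the point is that interior vertices of shortest paths can only be
  the identity, so that two vertices other than the identity are strongly resolved only by
  themselves.
\<close>

section \<open>Complete graphs with pendant vertices at one vertex\<close>

text \<open>Removing two elements at a time leaves at most one unpaired. Applied to the clique
  without its hub, this supplies the clique edges of a maximum matching.\<close>

lemma ex_disjoint_pairs:
  assumes "finite S"
  shows "\<exists>M. (\<forall>e \<in> M. e \<subseteq> S \<and> card e = 2) \<and> (\<forall>e \<in> M. \<forall>f \<in> M. e \<noteq> f \<longrightarrow> e \<inter> f = {}) \<and>
    card M = card S div 2"
  using assms
proof (induction "card S" arbitrary: S rule: less_induct)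
  case less
  show ?case
  proof (cases "card S < 2")
    case True
    then show ?thesis by (intro exI[of _ "{}"]) auto
  next
    case False
    then obtain P where P: "P \<subseteq> S" "card P = 2"
      by (metis not_less obtain_subset_with_card_n)
    have finP: "finite P" using P(2) card.infinite by fastforce
    have c: "card (S - P) = card S - 2"
      using P finP by (simp add: card_Diff_subset)
    obtain M where M: "\<forall>e \<in> M. e \<subseteq> S - P \<and> card e = 2"
      "\<forall>e \<in> M. \<forall>f \<in> M. e \<noteq> f \<longrightarrow> e \<inter> f = {}" "card M = card (S - P) div 2"
      using less(1)[of "S - P"] less(2) c False by auto
    have "finite M"
      using M(1) less(2) by (intro finite_subset[of M "Pow S"]) auto
    \<comment> \<open>Members of \<open>M\<close> lie in \<open>S - P\<close>, so \<open>P\<close>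
      could be one of them only if it were empty. Inserting it therefore raises the count to
      \<open>(card S - 2) div 2 + 1\<close>.\<close>
    moreover have "P \<notin> M"
    proof
      assume "P \<in> M"
      then have "P = {}" using M(1) by blast
      then show False using P(2) by simp
    qed
    ultimately have "card (insert P M) = card S div 2"
      using M(3) c False by simp
    moreover have "\<forall>e \<in> insert P M. e \<subseteq> S \<and> card e = 2"
      using M(1) P by blast
    moreover have "\<forall>e \<in> M. e \<inter> P = {}"
      using M(1) by blast
    then have "\<forall>e \<in> insert P M. \<forall>f \<in> insert P M. e \<noteq> f \<longrightarrow> e \<inter> f = {}"
      using M(2) by (metis Int_commute insert_iff)
    ultimately show ?thesis by (intro exI[of _ "insert P M"] conjI)
  qed
qed

text \<open>The shape is separated from the group, so that the invariants depend only on
  \<open>card A\<close> and \<open>card B\<close>. The hub \<open>c\<close> belongs to the clique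
  \<open>A\<close> and carries the leaves \<open>B\<close>. The bound on \<open>card A\<close>
  yields a clique vertex besides the hub, and \<open>B_ne\<close> yields a leaf to serve as
  witness.\<close>

locale pendant_clique =
  fixes \<Gamma> :: "'a graph" and A B :: "'a set" and c :: 'a
  assumes finite_A: "finite A" and finite_B: "finite B"
    and c_in: "c \<in> A" and disj: "A \<inter> B = {}"
    and card_A: "card A \<ge> 2" and B_ne: "B \<noteq> {}"
    and verts: "verts \<Gamma> = A \<union> B"
    and edges: "edges \<Gamma> = {{x, y} | x y. x \<noteq> y \<and> x \<in> A \<and> y \<in> A} \<union> {{c, y} | y. y \<in> B}"
begin

lemma adj_iff:
  "adj \<Gamma> u v \<longleftrightarrow> u \<noteq> v \<and> (u \<in> A \<and> v \<in> A \<or> u = c \<and> v \<in> B \<or> v = c \<and> u \<in> B)"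
  using c_in disj unfolding adj_def edges Un_iff mem_Collect_eq doubleton_eq_iff by blast

lemma edge_subset: "e \<in> edges \<Gamma> \<Longrightarrow> e \<subseteq> A \<union> B"
  using c_in by (auto simp: edges)

lemma finite_edges: "finite (edges \<Gamma>)"
  by (rule finite_subset[of _ "Pow (A \<union> B)"]) (use edge_subset finite_A finite_B in \<open>auto\<close>)

lemma card_A_minus: "card (A - {c}) = card A - 1"
  using c_in by simp

lemma ex_other: "\<exists>w. w \<in> A \<and> w \<noteq> c"
proof -
  have "card (A - {c}) \<noteq> 0" using card_A card_A_minus by simp
  then have "A - {c} \<noteq> {}" by (metis card.empty)
  then show ?thesis by blast
qed

section \<open>Degree, independence and matchings of a clique with leaves at one hub\<close>

lemma min_degree: "min_degree \<Gamma> = 1"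
proof -
  have one: "degree \<Gamma> v = 1" if "v \<in> B" for v
  proof -
    have "{e \<in> edges \<Gamma>. v \<in> e} = {{c, v}}"
      using that c_in disj by (auto simp: edges)
    then show ?thesis by (simp add: degree_def)
  qed
  have pos: "degree \<Gamma> v \<ge> 1" if v: "v \<in> A \<union> B" for v
  proof -
    \<comment> \<open>The hub is a neighbour of every other vertex; for the hub itself a second
      clique vertex is taken.\<close>
    obtain u where "{u, v} \<in> edges \<Gamma>"
    proof (cases "v = c")
      case True
      then show thesis using that ex_other c_in adj_iff unfolding adj_def by metis
    next
      case False
      then have "{c, v} \<in> edges \<Gamma>" using v c_in adj_iff[of c v] unfolding adj_def by blast
      then show thesis by (rule that)
    qed
    then have "{e \<in> edges \<Gamma>. v \<in> e} \<noteq> {}" by blast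
    then show ?thesis
      using finite_edges by (simp add: degree_def Suc_le_eq card_gt_0_iff)
  qed
  obtain v where "v \<in> B" using B_ne by blast
  then show ?thesis
    unfolding min_degree_def verts
    using finite_A finite_B pos one[of v] by (intro Min_eqI) (auto simp: image_iff intro!: bexI[of _ v])
qed

text \<open>An independent set has at most one vertex in the clique \<open>A\<close>. The bound is
  attained by all leaves together with a clique vertex other than the hub, since such a vertex has
  no leaf as neighbour.\<close>

lemma independence_number: "independence_number \<Gamma> = card B + 1"
  unfolding independence_number_def
proof (rule Max_eqI)
  show "finite {card S |S. independent_set \<Gamma> S}"
    by (rule finite_subset[of _ "card ` Pow (A \<union> B)"]) (use finite_A finite_B in \<open>auto simp: independent_set_def verts\<close>)
next
  fix k assume "k \<in> {card S |S. independent_set \<Gamma> S}"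
  then obtain S where k: "k = card S" and S: "S \<subseteq> A \<union> B"
    and ind: "\<And>u v. u \<in> S \<Longrightarrow> v \<in> S \<Longrightarrow> u \<noteq> v \<Longrightarrow> \<not> adj \<Gamma> u v"
    by (auto simp: independent_set_def verts)
  have "\<forall>u \<in> S \<inter> A. \<forall>v \<in> S \<inter> A. u = v"
    using ind adj_iff by blast
  then have "card (S \<inter> A) \<le> 1"
    using finite_A by (simp add: card_le_Suc0_iff_eq)
  moreover have "card (S \<inter> B) \<le> card B"
    using finite_B by (intro card_mono) auto
  moreover have "S = (S \<inter> A) \<union> (S \<inter> B)" using S by blast
  then have "card S \<le> card (S \<inter> A) + card (S \<inter> B)" by (metis card_Un_le)
  ultimately show "k \<le> card B + 1" using k by simp
next
  obtain w where w: "w \<in> A" "w \<noteq> c" using ex_other by blast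
  then have "independent_set \<Gamma> (insert w B)"
    using disj c_in by (auto simp: independent_set_def verts adj_iff)
  moreover have "card (insert w B) = card B + 1"
    using w disj finite_B by (subst card_insert_disjoint) auto
  ultimately show "card B + 1 \<in> {card S |S. independent_set \<Gamma> S}"
    by (intro CollectI exI[of _ "insert w B"]) simp
qed

text \<open>At most one matching edge meets the hub, and all others are disjoint pairs inside
  \<open>A - {c}\<close>. Equality is reached by spending the hub on a leaf, which leaves all of
  \<open>A - {c}\<close> to be paired off.\<close>

lemma matching_number: "matching_number \<Gamma> = (card A + 1) div 2"
  unfolding matching_number_def
proof (rule Max_eqI)
  show "finite {card M |M. matching \<Gamma> M}"
    by (rule finite_subset[of _ "card ` Pow (edges \<Gamma>)"]) (use finite_edges in \<open>auto simp: matching_def\<close>)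
next
  fix k assume "k \<in> {card M |M. matching \<Gamma> M}"
  then obtain M where k: "k = card M" and M: "M \<subseteq> edges \<Gamma>"
    and dis: "\<And>e f. e \<in> M \<Longrightarrow> f \<in> M \<Longrightarrow> e \<noteq> f \<Longrightarrow> e \<inter> f = {}"
    by (auto simp: matching_def)
  have fin: "finite M" using M finite_edges finite_subset by blast
  define N where "N = {e \<in> M. c \<notin> e}"
  have sub: "e \<subseteq> A - {c} \<and> card e = 2" if "e \<in> N" for e
    using that M by (auto simp: N_def edges)
  then have U: "\<Union>N \<subseteq> A - {c}" by blast
  \<comment> \<open>The edges avoiding \<open>c\<close> partition their union into blocks of size
    2.\<close>
  have "2 * card N = card (\<Union>N)"
    using fin U finite_A sub dis
    by (intro card_partition) (auto simp: N_def intro: finite_subset)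
  also have "\<dots> \<le> card A - 1"
    using U finite_A card_mono[of "A - {c}" "\<Union>N"] by (simp add: card_A_minus)
  finally have "2 * card N \<le> card A - 1" .
  moreover have "\<forall>e \<in> {e \<in> M. c \<in> e}. \<forall>f \<in> {e \<in> M. c \<in> e}. e = f"
    using dis by blast
  then have "card {e \<in> M. c \<in> e} \<le> 1"
    using fin by (simp add: card_le_Suc0_iff_eq)
  moreover have "M = {e \<in> M. c \<in> e} \<union> N" by (auto simp: N_def)
  then have "card M \<le> card {e \<in> M. c \<in> e} + card N" by (metis card_Un_le)
  \<comment> \<open>One edge at the hub plus at most \<open>(card A - 1) div 2\<close>
    others.\<close>
  ultimately show "k \<le> (card A + 1) div 2" using k card_A by simp
next
  obtain y where y: "y \<in> B" using B_ne by blast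
  obtain M where M: "\<forall>e \<in> M. e \<subseteq> A - {c} \<and> card e = 2"
    "\<forall>e \<in> M. \<forall>f \<in> M. e \<noteq> f \<longrightarrow> e \<inter> f = {}" "card M = card (A - {c}) div 2"
    using ex_disjoint_pairs[of "A - {c}"] finite_A by auto
  have "matching \<Gamma> (insert {c, y} M)"
    unfolding matching_def
  proof (intro conjI)
    have "e \<in> edges \<Gamma>" if "e \<in> M" for e
    proof -
      have "e \<subseteq> A - {c}" "card e = 2" using M(1) that by auto
      then show ?thesis unfolding edges card_2_iff by blast
    qed
    then show "insert {c, y} M \<subseteq> edges \<Gamma>"
      using y by (auto simp: edges)
    show "\<forall>e\<in>insert {c, y} M. \<forall>f\<in>insert {c, y} M. e \<noteq> f \<longrightarrow> e \<inter> f = {}"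
      using y M(1,2) disj by blast
  qed
  moreover have "card (insert {c, y} M) = (card A + 1) div 2"
  proof -
    have "finite M"
      using M(1) finite_A by (intro finite_subset[of M "Pow A"]) auto
    moreover have "{c, y} \<notin> M" using M(1) by blast
    ultimately show ?thesis using M(3) card_A card_A_minus by simp
  qed
  ultimately show "(card A + 1) div 2 \<in> {card M |M. matching \<Gamma> M}"
    by (intro CollectI exI[of _ "insert {c, y} M"]) simp
qed

section \<open>Shortest paths and strong resolution\<close>

lemma path_adj: "adj \<Gamma> u v \<Longrightarrow> is_path \<Gamma> u [u, v] v"
  using c_in by (auto simp: is_path_def adj_iff verts)

lemma path_through_hub:
  "\<lbrakk>u \<in> A \<union> B; v \<in> A \<union> B; u \<noteq> v; \<not> adj \<Gamma> u v\<rbrakk> \<Longrightarrow> is_path \<Gamma> u [u, c, v] v"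
  using c_in disj by (auto simp: is_path_def adj_iff verts)

text \<open>Any two distinct vertices are adjacent or joined through the hub, so a shortest path has
  at most one interior vertex. That vertex is a common neighbour of two distinct non-adjacent
  vertices, and only the hub can be one.\<close>

lemma shortest_path_interior:
  assumes p: "shortest_path \<Gamma> z p u" and v: "v \<in> set p" "v \<noteq> z" "v \<noteq> u"
  shows "v = c"
proof -
  have path: "is_path \<Gamma> z p u" and le: "\<And>q. is_path \<Gamma> z q u \<Longrightarrow> length p \<le> length q"
    using p by (auto simp: shortest_path_def)
  have p_props: "p \<noteq> []" "hd p = z" "last p = u" "distinct p" "set p \<subseteq> A \<union> B"
    "successively (adj \<Gamma>) p"
    using path by (auto simp: is_path_def verts)
  obtain q where q: "p = z # q" using p_props by (cases p) auto
  with v have "q \<noteq> []" by auto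
  then obtain r where r: "q = r @ [u]" using p_props(3) q by (metis append_butlast_last_id last_ConsR)
  have vr: "v \<in> set r" using v q r by auto
  have zu: "z \<noteq> u" "z \<in> A \<union> B" "u \<in> A \<union> B" using p_props q r by auto
  \<comment> \<open>An edge from \<open>z\<close> to \<open>u\<close> would be a path with two
    vertices, whereas \<open>p\<close> also contains \<open>v\<close>.\<close>
  have nadj: "\<not> adj \<Gamma> z u"
    using le[OF path_adj[of z u]] vr q r by auto
  have "length p \<le> 3"
    using le[OF path_through_hub[OF zu(2,3,1) nadj]] by simp
  then have "r = [v]" using vr q r by (cases r) auto
  then have "adj \<Gamma> z v" "adj \<Gamma> v u" using p_props(6) q r by auto
  \<comment> \<open>A leaf has only \<open>c\<close> as neighbour, which would force
    \<open>z = u\<close>. The neighbours of a clique vertex other than \<open>c\<close> all lie in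
    \<open>A\<close>, which would make \<open>z\<close> and \<open>u\<close> adjacent.\<close>
  then show ?thesis using nadj disj c_in zu by (auto simp: adj_iff)
qed

lemma ex_shortest_path:
  assumes "u \<in> A \<union> B" "v \<in> A \<union> B" "u \<noteq> v"
  shows "\<exists>p. shortest_path \<Gamma> u p v"
proof -
  have "\<exists>p. is_path \<Gamma> u p v" using path_adj path_through_hub[OF assms] by blast
  then show ?thesis
    unfolding shortest_path_def using ex_has_least_nat[of "\<lambda>p. is_path \<Gamma> u p v" _ length] by blast
qed

lemma strongly_resolves_self:
  assumes "u \<in> A \<union> B" "v \<in> A \<union> B" "u \<noteq> v"
  shows "strongly_resolves \<Gamma> u u v" "strongly_resolves \<Gamma> v u v"
proof -
  obtain p q where p: "shortest_path \<Gamma> u p v" and q: "shortest_path \<Gamma> v q u"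
    using ex_shortest_path assms by metis
  then have "u \<in> set p" "v \<in> set q"
    by (auto simp: shortest_path_def is_path_def)
  with p q show "strongly_resolves \<Gamma> u u v" "strongly_resolves \<Gamma> v u v"
    unfolding strongly_resolves_def by blast+
qed

text \<open>A strong resolving set can omit at most one vertex other than the hub, hence at most two
  vertices in all. Omitting the hub and one other clique vertex \<open>w\<close> is possible,
  because a leaf \<open>y\<close> resolves this pair along the path
  \<open>[y, c, w]\<close>.\<close>

lemma strong_metric_dimension: "strong_metric_dimension \<Gamma> = card A + card B - 2"
  unfolding strong_metric_dimension_def
proof (rule Min_eqI)
  show "finite {card U |U. strong_resolving_set \<Gamma> U}"
    by (rule finite_subset[of _ "card ` Pow (A \<union> B)"]) (use finite_A finite_B in \<open>auto simp: strong_resolving_set_def verts\<close>)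
next
  fix k assume "k \<in> {card U |U. strong_resolving_set \<Gamma> U}"
  then obtain U where k: "k = card U" and U: "U \<subseteq> A \<union> B"
    and res: "\<And>u v. u \<in> A \<union> B \<Longrightarrow> v \<in> A \<union> B \<Longrightarrow> u \<noteq> v \<Longrightarrow> \<exists>z \<in> U. strongly_resolves \<Gamma> z u v"
    by (auto simp: strong_resolving_set_def verts)
  \<comment> \<open>A resolver in \<open>U\<close> differs from both omitted vertices, so one of
    them would be interior to a shortest path and thus equal to \<open>c\<close>, which is
    excluded.\<close>
  have "u = v" if uv: "u \<in> (A \<union> B) - {c} - U" "v \<in> (A \<union> B) - {c} - U" for u v
  proof (rule ccontr)
    assume "u \<noteq> v"
    then obtain z where z: "z \<in> U" "strongly_resolves \<Gamma> z u v" using res[of u v] uv by blast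
    then show False
      using uv \<open>u \<noteq> v\<close> shortest_path_interior[of z _ u v] shortest_path_interior[of z _ v u]
      unfolding strongly_resolves_def by blast
  qed
  then have "card ((A \<union> B) - {c} - U) \<le> 1"
    using finite_A finite_B by (simp add: card_le_Suc0_iff_eq)
  moreover have "card (A \<union> B) \<le> card ({c} \<union> U \<union> ((A \<union> B) - {c} - U))"
    using U finite_A finite_B finite_subset[OF U] by (intro card_mono) auto
  then have "card (A \<union> B) \<le> card {c} + card U + card ((A \<union> B) - {c} - U)"
    by (meson add_le_mono1 card_Un_le le_trans)
  ultimately show "card A + card B - 2 \<le> k"
    using k card_Un_disjoint[OF finite_A finite_B disj] by simp
next
  obtain w where w: "w \<in> A" "w \<noteq> c" using ex_other by blast
  obtain y where y: "y \<in> B" using B_ne by blast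
  define U where "U = (A \<union> B) - {c, w}"
  have yU: "y \<in> U" using y w c_in disj by (auto simp: U_def)
  have hub: "shortest_path \<Gamma> y [y, c, w] w"
    unfolding shortest_path_def
  proof (intro conjI allI impI)
    show "is_path \<Gamma> y [y, c, w] w"
      using y w c_in disj by (intro path_through_hub) (auto simp: adj_iff)
    fix q assume q: "is_path \<Gamma> y q w"
    \<comment> \<open>These rule out paths with two vertices and with one vertex
      respectively.\<close>
    have "\<not> adj \<Gamma> y w" "y \<noteq> w" using y w c_in disj by (auto simp: adj_iff)
    then show "length [y, c, w] \<le> length q"
      using q by (cases q; cases "tl q"; cases "tl (tl q)") (auto simp: is_path_def)
  qed
  have "strong_resolving_set \<Gamma> U"
    unfolding strong_resolving_set_def verts
  proof (intro conjI ballI impI)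
    show "U \<subseteq> A \<union> B" by (auto simp: U_def)
    fix u v assume uv: "u \<in> A \<union> B" "v \<in> A \<union> B" "u \<noteq> v"
    show "\<exists>z \<in> U. strongly_resolves \<Gamma> z u v"
    proof (cases "u \<in> U \<or> v \<in> U")
      case True
      then show ?thesis using strongly_resolves_self[OF uv] by blast
    next
      case False
      then have "u = c \<and> v = w \<or> u = w \<and> v = c" using uv by (auto simp: U_def)
      then have "strongly_resolves \<Gamma> y u v"
        using hub unfolding strongly_resolves_def by (metis list.set_intros)
      then show ?thesis using yU by blast
    qed
  qed
  moreover have "card U = card A + card B - 2"
    using w c_in card_Un_disjoint[OF finite_A finite_B disj]
    unfolding U_def by (subst card_Diff_subset) auto
  ultimately show "card A + card B - 2 \<in> {card U |U. strong_resolving_set \<Gamma> U}"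
    by (intro CollectI exI[of _ U]) simp
qed

end

section \<open>The enhanced power graph of a dihedral group\<close>

text \<open>Replaces the quantifier over cyclic subgroups by one over their generators, so that
  adjacency can be decided by inspecting \<open>generate G {z}\<close> for each
  \<open>z\<close>.\<close>

lemma (in group) edges_enhanced_power_graph:
  "edges (enhanced_power_graph G) =
    {{x, y} | x y. x \<noteq> y \<and> (\<exists>z \<in> carrier G. x \<in> generate G {z} \<and> y \<in> generate G {z})}"
proof -
  have "(\<exists>C. subgroup C G \<and> cyclic_group (G\<lparr>carrier := C\<rparr>) \<and> x \<in> C \<and> y \<in> C) \<longleftrightarrow>
    (\<exists>z \<in> carrier G. x \<in> generate G {z} \<and> y \<in> generate G {z})" (is "?L \<longleftrightarrow> ?R") for x y
  proof
    assume ?L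
    then obtain C where C: "subgroup C G" "cyclic_group (G\<lparr>carrier := C\<rparr>)" "x \<in> C" "y \<in> C"
      by blast
    then obtain z where z: "z \<in> C" "subgroup_generated (G\<lparr>carrier := C\<rparr>) {z} = G\<lparr>carrier := C\<rparr>"
      unfolding cyclic_group_def by auto
    have "carrier (subgroup_generated (G\<lparr>carrier := C\<rparr>) {z}) = C"
      using z(2) by simp
    then have "generate (G\<lparr>carrier := C\<rparr>) {z} = C"
      using z(1) by (simp add: carrier_subgroup_generated)
    \<comment> \<open>Generation inside the subgroup \<open>C\<close> agrees with generation in
      \<open>G\<close>.\<close>
    then have "generate G {z} = C"
      using generate_consistent[of "{z}" C] z(1) C(1) by simp
    then show ?R
      using C z(1) subgroup.subset by blast
  next
    assume ?R
    then obtain z where z: "z \<in> carrier G" "x \<in> generate G {z}" "y \<in> generate G {z}" by blast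
    have "subgroup (generate G {z}) G" using z(1) by (simp add: generate_is_subgroup)
    moreover have "subgroup_generated G {z} = G\<lparr>carrier := generate G {z}\<rparr>"
      using z(1) by (simp add: subgroup_generated_def)
    then have "cyclic_group (G\<lparr>carrier := generate G {z}\<rparr>)"
      using cyclic_group_generated[of z] by simp
    ultimately show ?L using z by blast
  qed
  then show ?thesis by (simp add: enhanced_power_graph_def)
qed

lemma (in group) generate_involution:
  assumes "x \<in> carrier G" "x \<otimes> x = \<one>"
  shows "generate G {x} = {\<one>, x}"
proof (rule equalityI)
  have "inv x = x" using assms by (simp add: inv_equality)
  then have "subgroup {\<one>, x} G" using assms by (intro subgroupI) auto
  then show "generate G {x} \<subseteq> {\<one>, x}" by (intro generate_subgroup_incl) auto
qed (auto intro: generate.intros)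

text \<open>The normal forms \<open>a^i b^s\<close> split the group into the rotations
  \<open>A\<close>, which form the cyclic subgroup generated by \<open>a\<close>, and the
  reflections \<open>B\<close>, which are involutions. The identity is the hub.\<close>

lemma is_dihedral_pendant_clique:
  fixes G :: "('a, 'm) monoid_scheme"
  assumes n: "n \<ge> 2" and G: "is_dihedral G a b n"
  obtains A B where "pendant_clique (enhanced_power_graph G) A B \<one>\<^bsub>G\<^esub>" "card A = n" "card B = n"
proof -
  interpret group G using G by (simp add: is_dihedral_def)
  have ab: "a \<in> carrier G" "b \<in> carrier G" and gen: "generate G {a, b} = carrier G"
    and ord: "order G = 2 * n"
    and an: "a [^]\<^bsub>G\<^esub> n = \<one>\<^bsub>G\<^esub>" and bb: "b [^]\<^bsub>G\<^esub> (2::nat) = \<one>\<^bsub>G\<^esub>"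
    and swap: "a \<otimes>\<^bsub>G\<^esub> b = b \<otimes>\<^bsub>G\<^esub> inv\<^bsub>G\<^esub> a"
    using G by (auto simp: is_dihedral_def)
  define f where "f = (\<lambda>(i::nat, s). a [^]\<^bsub>G\<^esub> i \<otimes>\<^bsub>G\<^esub> (if s then b else \<one>\<^bsub>G\<^esub>))"
  define A where "A = f ` ({..<n} \<times> {False})"
  define B where "B = f ` ({..<n} \<times> {True})"
  have f_in: "f x \<in> carrier G" for x using ab by (auto simp: f_def split: prod.splits)
  have "carrier G \<subseteq> f ` ({..<n} \<times> UNIV)"
    unfolding gen[symmetric] f_def using n by (intro generate_dihedral_subset ab an bb swap) simp
  then have img: "f ` ({..<n} \<times> UNIV) = carrier G" using f_in by blast
  \<comment> \<open>A map from \<open>2 * n\<close> pairs onto a group of order \<open>2 * n\<close>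
    is injective. This is where the prescribed order rules out collapsed normal forms.\<close>
  have inj: "inj_on f ({..<n} \<times> UNIV)"
    using img ord by (intro eq_card_imp_inj_on) (auto simp: order_def card_cartesian_product)
  have cA: "card A = n" and cB: "card B = n"
    unfolding A_def B_def
    by (subst card_image[OF inj_on_subset[OF inj]]; force simp: card_cartesian_product)+
  have disj: "A \<inter> B = {}"
    unfolding A_def B_def by (subst inj_on_image_Int[OF inj, symmetric]) auto
  have carr: "carrier G = A \<union> B"
    unfolding img[symmetric] A_def B_def by (auto simp: UNIV_bool)
  have finA: "finite A" and finB: "finite B" by (simp_all add: A_def B_def)
  have A_sub: "A \<subseteq> generate G {a}"
  proof
    fix x assume "x \<in> A"
    then obtain i :: nat where "x = a [^]\<^bsub>G\<^esub> i" using ab by (auto simp: A_def f_def)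
    then show "x \<in> generate G {a}"
      using ab generate_pow[of a] by (auto simp: int_pow_int intro!: exI[of _ "int i"])
  qed
  have genA: "generate G {a} = A"
  proof
    show "generate G {a} \<subseteq> A"
    proof
      fix x assume "x \<in> generate G {a}"
      then obtain k :: int where k: "x = a [^]\<^bsub>G\<^esub> k" using ab by (auto simp: generate_pow)
      \<comment> \<open>Division with remainder brings the integer exponent, possibly negative, into
        the range below \<open>n\<close>.\<close>
      have "a [^]\<^bsub>G\<^esub> k = a [^]\<^bsub>G\<^esub> (int n * (k div int n)) \<otimes>\<^bsub>G\<^esub> a [^]\<^bsub>G\<^esub> (k mod int n)"
        using ab by (simp flip: int_pow_mult)
      also have "a [^]\<^bsub>G\<^esub> (int n * (k div int n)) = \<one>\<^bsub>G\<^esub>"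
        using ab an by (simp add: int_pow_int flip: int_pow_pow)
      also have "k mod int n = int (nat (k mod int n))" using n by simp
      finally have "x = f (nat (k mod int n), False)"
        using k ab by (simp add: f_def int_pow_int)
      moreover have "nat (k mod int n) < n" using n by (simp add: nat_less_iff)
      ultimately show "x \<in> A" by (auto simp: A_def)
    qed
  qed (fact A_sub)
  have one_A: "\<one>\<^bsub>G\<^esub> \<in> A" using generate.one genA by blast
  have inv_B: "x \<otimes>\<^bsub>G\<^esub> x = \<one>\<^bsub>G\<^esub>" if x_B: "x \<in> B" for x
  proof -
    obtain i :: nat where x: "x = a [^]\<^bsub>G\<^esub> i \<otimes>\<^bsub>G\<^esub> b" using x_B by (auto simp: B_def f_def)
    have b2: "b \<otimes>\<^bsub>G\<^esub> b = \<one>\<^bsub>G\<^esub>" using bb ab by (simp add: numeral_2_eq_2)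
    \<comment> \<open>Passing \<open>b\<close> across a power of \<open>a\<close> inverts that
      power, so in the square of a reflection the two powers cancel and only \<open>b\<close>
      squared remains.\<close>
    have *: "a [^]\<^bsub>G\<^esub> j \<otimes>\<^bsub>G\<^esub> b = b \<otimes>\<^bsub>G\<^esub> inv\<^bsub>G\<^esub> a [^]\<^bsub>G\<^esub> j" for j :: nat
    proof (induction j)
      case (Suc j)
      have "a [^]\<^bsub>G\<^esub> Suc j \<otimes>\<^bsub>G\<^esub> b = a [^]\<^bsub>G\<^esub> j \<otimes>\<^bsub>G\<^esub> (a \<otimes>\<^bsub>G\<^esub> b)"
        using ab by (simp add: m_assoc)
      also have "\<dots> = (a [^]\<^bsub>G\<^esub> j \<otimes>\<^bsub>G\<^esub> b) \<otimes>\<^bsub>G\<^esub> inv\<^bsub>G\<^esub> a"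
        using ab swap by (simp add: m_assoc)
      finally show ?case using Suc ab by (simp add: m_assoc)
    qed (use ab in simp)
    have "x \<otimes>\<^bsub>G\<^esub> x = b \<otimes>\<^bsub>G\<^esub> (inv\<^bsub>G\<^esub> a [^]\<^bsub>G\<^esub> i \<otimes>\<^bsub>G\<^esub> a [^]\<^bsub>G\<^esub> i) \<otimes>\<^bsub>G\<^esub> b"
      using ab x *[of i] by (simp add: m_assoc)
    also have "inv\<^bsub>G\<^esub> a [^]\<^bsub>G\<^esub> i \<otimes>\<^bsub>G\<^esub> a [^]\<^bsub>G\<^esub> i = \<one>\<^bsub>G\<^esub>"
      using ab by (simp add: nat_pow_inv)
    finally show ?thesis using ab b2 by simp
  qed
  \<comment> \<open>\<open>A\<close> is itself a subgroup, being generated by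
    \<open>a\<close>.\<close>
  have gen_A: "generate G {z} \<subseteq> A" if "z \<in> A" for z
    using that generate_subgroup_incl[of "{z}" A] generate_is_subgroup[of "{a}"] ab genA by auto
  have gen_B: "generate G {z} = {\<one>\<^bsub>G\<^esub>, z}" if "z \<in> B" for z
    using that inv_B carr by (intro generate_involution) auto
  \<comment> \<open>A common generator is a rotation, whose powers stay in \<open>A\<close>, or a
    reflection, which generates only itself and the identity. The form
    \<open>{x, y} \<subseteq> ...\<close> covers both orders of the two vertices.\<close>
  have common: "(\<exists>z \<in> carrier G. x \<in> generate G {z} \<and> y \<in> generate G {z}) \<longleftrightarrow>
      x \<in> A \<and> y \<in> A \<or> (\<exists>z \<in> B. {x, y} \<subseteq> {\<one>\<^bsub>G\<^esub>, z})"
    (is "?L \<longleftrightarrow> ?R") for x y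
  proof
    assume ?L
    then obtain z where z: "z \<in> A \<union> B" "x \<in> generate G {z}" "y \<in> generate G {z}"
      using carr by blast
    show ?R
    proof (cases "z \<in> A")
      case True
      then show ?thesis using gen_A z by blast
    next
      case False
      then have "z \<in> B" using z(1) by blast
      then show ?thesis using gen_B[of z] z by auto
    qed
  next
    assume ?R
    then show ?L
    proof
      assume "x \<in> A \<and> y \<in> A"
      then show ?L using ab(1) genA by blast
    next
      assume "\<exists>z \<in> B. {x, y} \<subseteq> {\<one>\<^bsub>G\<^esub>, z}"
      then obtain z where "z \<in> B" "{x, y} \<subseteq> {\<one>\<^bsub>G\<^esub>, z}" by blast
      then show ?L using gen_B[of z] carr by (intro bexI[of _ z]) auto
    qed
  qed
  have "edges (enhanced_power_graph G) =
      {{x, y} | x y. x \<noteq> y \<and> x \<in> A \<and> y \<in> A} \<union> {{\<one>\<^bsub>G\<^esub>, y} | y. y \<in> B}"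
    (is "?L = ?R1 \<union> ?R2")
  proof
    show "?L \<subseteq> ?R1 \<union> ?R2"
      unfolding edges_enhanced_power_graph common by blast
    \<comment> \<open>Edges need distinct ends, and the identity is a rotation.\<close>
    have "\<one>\<^bsub>G\<^esub> \<noteq> y" if "y \<in> B" for y using that disj one_A by blast
    then show "?R1 \<union> ?R2 \<subseteq> ?L"
      unfolding edges_enhanced_power_graph common by blast
  qed
  then have "pendant_clique (enhanced_power_graph G) A B \<one>\<^bsub>G\<^esub>"
    using finA finB one_A disj cA cB n carr
    by unfold_locales (auto simp: enhanced_power_graph_def)
  with cA cB that show thesis by blast
qed

theorem theorem3p32:
  fixes G :: "('a, 'm) monoid_scheme" and a b :: 'a and n :: nat
  assumes "n \<ge> 2" and "is_dihedral G a b n"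
  shows "min_degree (enhanced_power_graph G) = 1 \<and>
    independence_number (enhanced_power_graph G) = n + 1 \<and>
    int (matching_number (enhanced_power_graph G)) = \<lceil>real n / 2\<rceil> \<and>
    strong_metric_dimension (enhanced_power_graph G) = 2 * (n - 1)"
proof -
  obtain A B where "pendant_clique (enhanced_power_graph G) A B \<one>\<^bsub>G\<^esub>"
    and card: "card A = n" "card B = n"
    by (rule is_dihedral_pendant_clique[OF assms])
  then interpret pendant_clique "enhanced_power_graph G" A B "\<one>\<^bsub>G\<^esub>" by simp
  \<comment> \<open>Matches the real ceiling with the natural-number quotient
    \<open>(card A + 1) div 2\<close> by parity of \<open>n\<close>.\<close>
  have "\<lceil>real n / 2\<rceil> = int ((n + 1) div 2)"
    by (cases "even n") (auto elim!: evenE oddE intro!: ceiling_unique)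
  then show ?thesis
    using min_degree independence_number matching_number strong_metric_dimension card assms(1)
    by simp
qed

end
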